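(* Algorithm 1 (described in the context) is correct for the ILP consistency problem for $\mathcal{G}^*$: on every input $E^+ \neq \emptyset$, $E^-$ of ground straight clauses in which every signed relation name occurring in a clause of $E^+$ occurs in all clauses of $E^+$, it returns a guarded clause $H$ with $H \vdash E^+$ and $H \not\vdash E^-$ whenever such a guarded clause exists, and rejects otherwise.
   Context: Clauses are finite disjunctions of first-order literals, treated as sets of literals. A signed relation name is a relation name together with the polarity of a literal in which it occurs. A clause is straight if no signed relation name occurs in it twice. $\phi \vdash \psi$ ($\theta$-subsumption) means there is a variable substitution $\theta$ with $\phi\theta\subseteq\psi$; $H \vdash E$ means $H\vdash C$ for all $C\in E$, $H \not\vdash E$ means $H \not\vdash C$ for all $C \in E$. A clause is guarded if it contains a literal in which all its variables occur. The setting $\mathcal{G}^*$: given a set $E^+$ of straight ground clauses and a set $E^-$ of ground clauses, decide whether there is a function-free guarded clause $H$ with $H \vdash E^+$ and $H \not\vdash E^-$. For a clause $C$ in which signed relation name $P$ occurs once, $\pi^C_{P,i}$ is the term at position $i$ of that literal. Relative shield: $S^E_{P,Q,i} = \bigcap_{C\in E}\{ j \mid \pi^C_{P,j} = \pi^C_{Q,i}\}$. The least general induced guard (lgig) for $P$ induced by $E$ is the literal $P(\bar x)$ with the fewest distinct variables such that $P(\bar x) \vdash \{P(\bar a)\}$ for every literal $P(\bar a)$ in a clause of $E$; equivalently $x_i = x_j$ iff $\pi^C_{P,i} = \pi^C_{P,j}$ for all $C\in E$. Lgig map: given the lgig $G' = P(\bar x)$ for $P$ induced by $E^+$ and a literal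 $L$ with signed relation name $Q$ in a clause of $E^+$, the lgig map of $L$ exists iff $S^{E^+}_{P,Q,i} \neq \emptyset$ for every position $i$ of $L$, and then $\mu(L)$ is the literal with the same sign and relation as $L$ whose $i$-th argument is $x_j$ for any $j \in S^{E^+}_{P,Q,i}$ (independent of the choice of $j$). Algorithm 1: pick an arbitrary $C \in E^+$. For each literal $G \in C$: let $G'$ be the lgig for the signed relation name of $G$ induced by $E^+$ and set $H := \{G'\}$; if $H \not\vdash E^-$, return $H$. Then for each $L \in C\setminus\{G\}$ in turn: if the lgig map of $L$ w.r.t. $G'$ exists and $H \cup \{\mu(L)\} \vdash E^+$, set $H := H\cup\{\mu(L)\}$. After this loop, if $H \not\vdash E^-$, return $H$. If no $G$ led to a return, reject. *)

theory Defs
  imports Main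
begin

(* Constants are function symbols applied to the empty list; the datatype set functions
   collect the function symbols and the variables of a term. *)
datatype (funs_term: 'f, vars_term: 'v) fo_term =
  Var 'v | Fun 'f "('f, 'v) fo_term list"

(* The Boolean is the polarity (True = positive). *)
datatype (funs_lit: 'f, vars_lit: 'v, rels_lit: 'r) literal =
  Lit (sign: bool) (rel: 'r) (args: "('f, 'v) fo_term list")

type_synonym ('f, 'v, 'r) clause = "('f, 'v, 'r) literal set"

type_synonym 'r signed_rel = "bool \<times> 'r"

definition signed_rel :: "('f, 'v, 'r) literal \<Rightarrow> 'r signed_rel" where
  "signed_rel L = (sign L, rel L)"

definition is_clause :: "('r \<Rightarrow> nat) \<Rightarrow> ('f, 'v, 'r) clause \<Rightarrow> bool" where
  "is_clause ar C \<longleftrightarrow> finite C \<and> (\<forall>L\<in>C. length (args L) = ar (rel L))"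

definition ground :: "('f, 'v, 'r) clause \<Rightarrow> bool" where
  "ground C \<longleftrightarrow> (\<forall>L\<in>C. vars_lit L = {})"

(* Constants count as function symbols, so the arguments in a function-free clause are
   variables. *)
definition function_free :: "('f, 'v, 'r) clause \<Rightarrow> bool" where
  "function_free C \<longleftrightarrow> (\<forall>L\<in>C. funs_lit L = {})"

definition guarded :: "('f, 'v, 'r) clause \<Rightarrow> bool" where
  "guarded C \<longleftrightarrow> (\<exists>G\<in>C. \<Union> (vars_lit ` C) \<subseteq> vars_lit G)"

definition straight :: "('f, 'v, 'r) clause \<Rightarrow> bool" where
  "straight C \<longleftrightarrow> inj_on signed_rel C"

primrec subst_term :: "('v \<Rightarrow> ('f, 'v) fo_term) \<Rightarrow> ('f, 'v) fo_term \<Rightarrow> ('f, 'v) fo_term" where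
  "subst_term \<theta> (Var x) = \<theta> x"
| "subst_term \<theta> (Fun f ts) = Fun f (map (subst_term \<theta>) ts)"

definition subst_lit ::
  "('v \<Rightarrow> ('f, 'v) fo_term) \<Rightarrow> ('f, 'v, 'r) literal \<Rightarrow> ('f, 'v, 'r) literal" where
  "subst_lit \<theta> L = Lit (sign L) (rel L) (map (subst_term \<theta>) (args L))"

definition subsumes :: "('f, 'v, 'r) clause \<Rightarrow> ('f, 'v, 'r) clause \<Rightarrow> bool" where
  "subsumes H C \<longleftrightarrow> (\<exists>\<theta>. subst_lit \<theta> ` H \<subseteq> C)"

definition subsumes_all :: "('f, 'v, 'r) clause \<Rightarrow> ('f, 'v, 'r) clause set \<Rightarrow> bool" where
  "subsumes_all H E \<longleftrightarrow> (\<forall>C\<in>E. subsumes H C)"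

(* Stronger than the negation of subsumes_all. *)
definition subsumes_none :: "('f, 'v, 'r) clause \<Rightarrow> ('f, 'v, 'r) clause set \<Rightarrow> bool" where
  "subsumes_none H E \<longleftrightarrow> (\<forall>C\<in>E. \<not> subsumes H C)"

definition consistent_guarded_clause ::
  "('r \<Rightarrow> nat) \<Rightarrow> ('f, 'v, 'r) clause set \<Rightarrow> ('f, 'v, 'r) clause set
    \<Rightarrow> ('f, 'v, 'r) clause \<Rightarrow> bool" where
  "consistent_guarded_clause ar Ep En H \<longleftrightarrow>
     is_clause ar H \<and> function_free H \<and> guarded H \<and> subsumes_all H Ep \<and> subsumes_none H En"

(* The following two are meaningful only if P occurs exactly once in C. Positions are
   counted from 0. *)
definition args_of :: "('f, 'v, 'r) clause \<Rightarrow> 'r signed_rel \<Rightarrow> ('f, 'v) fo_term list" where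
  "args_of C P = args (THE L. L \<in> C \<and> signed_rel L = P)"

definition proj :: "('f, 'v, 'r) clause \<Rightarrow> 'r signed_rel \<Rightarrow> nat \<Rightarrow> ('f, 'v) fo_term" where
  "proj C P i = args_of C P ! i"

definition rel_shield ::
  "('f, 'v, 'r) clause set \<Rightarrow> 'r signed_rel \<Rightarrow> 'r signed_rel \<Rightarrow> nat \<Rightarrow> nat set" where
  "rel_shield E P Q i = (\<Inter>C\<in>E. {j. j < length (args_of C P) \<and> proj C P j = proj C Q i})"

definition induced_guard ::
  "('f, 'v, 'r) clause set \<Rightarrow> 'r signed_rel \<Rightarrow> ('f, 'v, 'r) literal \<Rightarrow> bool" where
  "induced_guard E P G \<longleftrightarrow>
     signed_rel G = P \<and> set (args G) \<subseteq> range Var \<and>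
     (\<forall>C\<in>E. \<forall>L\<in>C. signed_rel L = P \<longrightarrow> subsumes {G} {L})"

(* Unique only up to renaming of variables; arg_min picks some representative. *)
definition lgig ::
  "('f, 'v, 'r) clause set \<Rightarrow> 'r signed_rel \<Rightarrow> ('f, 'v, 'r) literal" where
  "lgig E P = arg_min (\<lambda>G. card (vars_lit G)) (induced_guard E P)"

definition lgig_map_exists ::
  "('f, 'v, 'r) clause set \<Rightarrow> ('f, 'v, 'r) literal \<Rightarrow> ('f, 'v, 'r) literal \<Rightarrow> bool" where
  "lgig_map_exists E G' L \<longleftrightarrow>
     (\<forall>i<length (args L). rel_shield E (signed_rel G') (signed_rel L) i \<noteq> {})"

(* For an lgig G', the argument does not depend on which j in the shield is chosen. *)
definition lgig_map ::
  "('f, 'v, 'r) clause set \<Rightarrow> ('f, 'v, 'r) literal \<Rightarrow> ('f, 'v, 'r) literal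
    \<Rightarrow> ('f, 'v, 'r) literal" where
  "lgig_map E G' L =
     Lit (sign L) (rel L)
       (map (\<lambda>i. args G' ! (SOME j. j \<in> rel_shield E (signed_rel G') (signed_rel L) i))
         [0..<length (args L)])"

definition extend ::
  "('f, 'v, 'r) clause set \<Rightarrow> ('f, 'v, 'r) literal \<Rightarrow> ('f, 'v, 'r) literal
    \<Rightarrow> ('f, 'v, 'r) clause \<Rightarrow> ('f, 'v, 'r) clause" where
  "extend Ep G' L H =
     (if lgig_map_exists Ep G' L \<and> subsumes_all (H \<union> {lgig_map Ep G' L}) Ep
      then H \<union> {lgig_map Ep G' L} else H)"

definition enumerates :: "'a list \<Rightarrow> 'a set \<Rightarrow> bool" where
  "enumerates xs A \<longleftrightarrow> distinct xs \<and> set xs = A"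

(* The nondeterminism of the two loops over the picked clause is made explicit: the last
   argument lists the literals of that clause in the order of the outer loop, and ord G
   lists the remaining literals in the order of the inner loop for G. None is rejection. *)
primrec algorithm1 ::
  "('f, 'v, 'r) clause set \<Rightarrow> ('f, 'v, 'r) clause set
    \<Rightarrow> (('f, 'v, 'r) literal \<Rightarrow> ('f, 'v, 'r) literal list)
    \<Rightarrow> ('f, 'v, 'r) literal list \<Rightarrow> ('f, 'v, 'r) clause option" where
  "algorithm1 Ep En ord [] = None"
| "algorithm1 Ep En ord (G # Gs) =
     (let G' = lgig Ep (signed_rel G);
          H = fold (extend Ep G') (ord G) {G'}
      in if subsumes_none {G'} En then Some {G'}
         else if subsumes_none H En then Some H
         else algorithm1 Ep En ord Gs)"

end

theory Submission
  imports Defs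
begin

text \<open>
  An lgig identifies exactly those positions of a signed relation that carry equal terms in every
  positive example. If a guarded clause \<open>H\<close> with guard \<open>G\<^sub>0\<close> subsumes all positive examples, then
  sending the argument of \<open>G\<^sub>0\<close> at each position to the argument of the lgig at the same position is
  therefore a well-defined substitution, and it maps every literal of \<open>H\<close> to the lgig or to an lgig
  map. The algorithm collects all lgig maps, because a substitution instantiating the lgig to its
  occurrence in an example instantiates every lgig map to a literal of that example. So the clause
  it builds for the signed relation of \<open>G\<^sub>0\<close> contains an instance of \<open>H\<close>, and it subsumes a negative
  example only if \<open>H\<close> does.
\<close>

section \<open>Terms, substitutions and subsumption\<close>

lemma vars_lit_eq: "vars_lit L = \<Union> (vars_term ` set (args L))"
  by (cases L) auto

lemma funs_lit_eq: "funs_lit L = \<Union> (funs_term ` set (args L))"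
  by (cases L) auto

lemma finite_vars_term: "finite (vars_term t)"
  by (induction t) auto

lemma finite_vars_lit: "finite (vars_lit L)"
  unfolding vars_lit_eq by (simp add: finite_vars_term)

lemma funs_term_empty_iff: "funs_term t = {} \<longleftrightarrow> t \<in> range Var"
  by (cases t) auto

lemma function_free_iff: "function_free C \<longleftrightarrow> (\<forall>L\<in>C. set (args L) \<subseteq> range Var)"
  unfolding function_free_def funs_lit_eq using funs_term_empty_iff by fastforce

lemma subst_lit_sel [simp]:
  "args (subst_lit \<theta> L) = map (subst_term \<theta>) (args L)"
  "signed_rel (subst_lit \<theta> L) = signed_rel L"
  by (simp_all add: subst_lit_def signed_rel_def)

lemma literal_eqI: "signed_rel L = signed_rel L' \<Longrightarrow> args L = args L' \<Longrightarrow> L = L'"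
  by (cases L; cases L') (auto simp: signed_rel_def)

lemma subst_term_subst_term:
  "subst_term \<theta> (subst_term \<sigma> t) = subst_term (\<lambda>x. subst_term \<theta> (\<sigma> x)) t"
  by (induction t) auto

lemma subst_lit_subst_lit:
  "subst_lit \<theta> (subst_lit \<sigma> L) = subst_lit (\<lambda>x. subst_term \<theta> (\<sigma> x)) L"
  by (simp add: subst_lit_def subst_term_subst_term)

text \<open>Substitutions compose. Read contrapositively, a clause containing an instance of
  \<open>H\<close> subsumes no negative example that \<open>H\<close> avoids.\<close>

lemma subsumes_if_instance:
  assumes "subst_lit \<sigma> ` H \<subseteq> H'" and "subsumes H' D"
  shows "subsumes H D"
proof -
  obtain \<theta> where "subst_lit \<theta> ` H' \<subseteq> D"
    using assms(2) by (auto simp: subsumes_def)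
  then have "subst_lit (\<lambda>x. subst_term \<theta> (\<sigma> x)) ` H \<subseteq> D"
    using assms(1) by (fastforce simp flip: subst_lit_subst_lit)
  then show ?thesis
    by (auto simp: subsumes_def)
qed

text \<open>Each variable goes to the entry of \<open>us\<close> at some position carrying it; the
  last assumption makes the choice of position irrelevant.\<close>

lemma exists_subst_map_eq:
  assumes "set ts \<subseteq> range Var" and "length ts = length us"
    and "\<And>i j. i < length ts \<Longrightarrow> j < length ts \<Longrightarrow> ts ! i = ts ! j \<Longrightarrow> us ! i = us ! j"
  shows "\<exists>\<theta>. map (subst_term \<theta>) ts = us"
proof -
  define \<theta> where "\<theta> x = us ! (SOME i. i < length ts \<and> ts ! i = Var x)" for x
  have "subst_term \<theta> (ts ! i) = us ! i" if i: "i < length ts" for i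
  proof -
    obtain x where x: "ts ! i = Var x"
      using assms(1) i nth_mem by blast
    define k where "k = (SOME i. i < length ts \<and> ts ! i = Var x)"
    have "k < length ts \<and> ts ! k = Var x"
      unfolding k_def by (rule someI[of _ i]) (simp add: i x)
    then have "us ! k = us ! i"
      using assms(3) i x by metis
    then show ?thesis
      by (simp add: x \<theta>_def k_def)
  qed
  then have "map (subst_term \<theta>) ts = us"
    using assms(2) by (auto intro: nth_equalityI)
  then show ?thesis
    by blast
qed

section \<open>Positions in straight clauses and in lgig maps\<close>

lemma args_of_eq:
  assumes "straight D" and "L \<in> D"
  shows "args_of D (signed_rel L) = args L"
proof -
  have "(THE K. K \<in> D \<and> signed_rel K = signed_rel L) = L"
    using assms by (auto simp: straight_def inj_on_def intro!: the_equality)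
  then show ?thesis
    by (simp add: args_of_def)
qed

lemma signed_rel_lgig_map [simp]: "signed_rel (lgig_map E G L) = signed_rel L"
  by (simp add: lgig_map_def signed_rel_def)

lemma length_args_lgig_map [simp]: "length (args (lgig_map E G L)) = length (args L)"
  by (simp add: lgig_map_def)

text \<open>Hides the \<open>SOME\<close> in \<open>lgig_map\<close>: later proofs only use that
  some position in the shield supplies the argument.\<close>

lemma args_lgig_map_nth:
  assumes "lgig_map_exists E G L" and "i < length (args L)"
  obtains j where "j \<in> rel_shield E (signed_rel G) (signed_rel L) i"
    and "args (lgig_map E G L) ! i = args G ! j"
proof
  let ?S = "rel_shield E (signed_rel G) (signed_rel L) i"
  show "(SOME j. j \<in> ?S) \<in> ?S"
    using assms by (auto simp: lgig_map_exists_def intro: some_in_eq[THEN iffD2])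
  show "args (lgig_map E G L) ! i = args G ! (SOME j. j \<in> ?S)"
    using assms(2) by (simp add: lgig_map_def)
qed

section \<open>Examples sharing the same signed relations\<close>

locale uniform_straight_examples =
  fixes ar :: "'r \<Rightarrow> nat" and E :: "('f, 'v, 'r) clause set"
  assumes infinite_vars: "infinite (UNIV :: 'v set)"
    and nonempty: "E \<noteq> {}"
    and clause: "D \<in> E \<Longrightarrow> is_clause ar D"
    and straight: "D \<in> E \<Longrightarrow> straight D"
    and uniform: "D \<in> E \<Longrightarrow> D' \<in> E \<Longrightarrow> signed_rel ` D = signed_rel ` D'"
begin

definition occurs :: "'r signed_rel \<Rightarrow> bool" where
  "occurs P \<longleftrightarrow> (\<exists>D\<in>E. P \<in> signed_rel ` D)"

lemma occursI: "D \<in> E \<Longrightarrow> L \<in> D \<Longrightarrow> occurs (signed_rel L)"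
  by (auto simp: occurs_def)

lemma occurs_in_example:
  assumes "occurs P" and "D \<in> E"
  obtains L where "L \<in> D" and "signed_rel L = P" and "args L = args_of D P"
proof -
  obtain D' where "D' \<in> E" and "P \<in> signed_rel ` D'"
    using assms(1) by (auto simp: occurs_def)
  then have "P \<in> signed_rel ` D"
    using uniform[OF assms(2)] by simp
  then obtain L where "L \<in> D" and "signed_rel L = P"
    by blast
  then show thesis
    using that args_of_eq straight[OF assms(2)] by metis
qed

lemma length_args_of: "occurs P \<Longrightarrow> D \<in> E \<Longrightarrow> length (args_of D P) = ar (snd P)"
  using clause by (metis is_clause_def occurs_in_example signed_rel_def snd_conv)

text \<open>Nonemptiness of \<open>E\<close> matters: an intersection over the empty family would
  lose the bound on \<open>j\<close>.\<close>

lemma in_rel_shield_iff: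
  assumes "occurs P"
  shows "j \<in> rel_shield E P Q i \<longleftrightarrow> j < ar (snd P) \<and> (\<forall>D\<in>E. proj D P j = proj D Q i)"
  using assms nonempty by (auto simp: rel_shield_def length_args_of)

section \<open>Induced guards and lgigs\<close>

text \<open>Straightness leaves a single literal of \<open>P\<close> in each \<open>D\<close>, so
  the condition on all such literals becomes one matching problem against
  \<open>args_of D P\<close>.\<close>

lemma induced_guard_iff:
  assumes "occurs P"
  shows "induced_guard E P G \<longleftrightarrow>
    signed_rel G = P \<and> set (args G) \<subseteq> range Var \<and>
    (\<forall>D\<in>E. \<exists>\<theta>. map (subst_term \<theta>) (args G) = args_of D P)"
proof -
  have *: "(\<forall>L\<in>D. signed_rel L = P \<longrightarrow> subsumes {G} {L}) \<longleftrightarrow>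
      (\<exists>\<theta>. map (subst_term \<theta>) (args G) = args_of D P)"
    if D: "D \<in> E" and G: "signed_rel G = P" for D
  proof -
    obtain L where L: "L \<in> D" "signed_rel L = P" "args L = args_of D P"
      using assms D by (rule occurs_in_example)
    have "K = L" if "K \<in> D" "signed_rel K = P" for K
      using straight[OF D] that L by (auto simp: straight_def inj_on_def)
    then have "(\<forall>K\<in>D. signed_rel K = P \<longrightarrow> subsumes {G} {K}) \<longleftrightarrow> subsumes {G} {L}"
      using L by blast
    also have "\<dots> \<longleftrightarrow> (\<exists>\<theta>. subst_lit \<theta> G = L)"
      by (simp add: subsumes_def)
    also have "\<dots> \<longleftrightarrow> (\<exists>\<theta>. map (subst_term \<theta>) (args G) = args_of D P)"
      using G L by (metis literal_eqI subst_lit_sel)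
    finally show ?thesis .
  qed
  show ?thesis
    unfolding induced_guard_def by (simp add: * cong: conj_cong)
qed

text \<open>Pairwise distinct variables can be instantiated to any list of the same length, and an
  infinite supply of variables covers every arity. Existence ensures that the \<open>arg_min\<close>
  in \<open>lgig\<close> is an induced guard.\<close>

lemma exists_induced_guard:
  assumes P: "occurs P"
  shows "\<exists>G. induced_guard E P G"
proof -
  obtain V :: "'v set" where "finite V" "card V = ar (snd P)"
    using infinite_arbitrarily_large[OF infinite_vars] by metis
  then obtain xs :: "'v list" where xs: "distinct xs" "length xs = ar (snd P)"
    by (metis finite_distinct_list distinct_card)
  have "\<exists>\<theta>. map (subst_term \<theta>) (map Var xs) = args_of D P" if "D \<in> E" for D
    using that xs P by (intro exists_subst_map_eq) (auto simp: length_args_of nth_eq_iff_index_eq)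
  then have "induced_guard E P (Lit (fst P) (snd P) (map Var xs))"
    using P by (auto simp: induced_guard_iff signed_rel_def)
  then show ?thesis ..
qed

lemma induced_guard_lgig: "occurs P \<Longrightarrow> induced_guard E P (lgig E P)"
  using exists_induced_guard unfolding lgig_def by (blast intro: arg_min_natI)

lemma signed_rel_lgig [simp]: "occurs P \<Longrightarrow> signed_rel (lgig E P) = P"
  using induced_guard_lgig by (simp add: induced_guard_def)

lemma args_lgig_vars: "occurs P \<Longrightarrow> set (args (lgig E P)) \<subseteq> range Var"
  using induced_guard_lgig by (simp add: induced_guard_def)

lemma lgig_instance:
  assumes "occurs P" and "D \<in> E"
  obtains \<theta> where "map (subst_term \<theta>) (args (lgig E P)) = args_of D P"
  using induced_guard_lgig[OF assms(1)] assms by (auto simp: induced_guard_iff)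

text \<open>\<open>induced_guard\<close> does not mention arities. The length is forced because
  instantiation preserves it and there is an example to match.\<close>

lemma length_args_lgig:
  assumes "occurs P"
  shows "length (args (lgig E P)) = ar (snd P)"
proof -
  obtain D where "D \<in> E"
    using nonempty by blast
  then show ?thesis
    using assms by (metis lgig_instance length_args_of length_map)
qed

text \<open>If the two arguments were distinct variables, merging them would give an induced guard with
  fewer variables.\<close>

lemma lgig_args_eqI:
  assumes P: "occurs P" and i: "i < ar (snd P)" and j: "j < ar (snd P)"
    and eq: "\<And>D. D \<in> E \<Longrightarrow> proj D P i = proj D P j"
  shows "args (lgig E P) ! i = args (lgig E P) ! j"
proof (rule ccontr)
  define G where "G = lgig E P"
  assume ne: "args (lgig E P) ! i \<noteq> args (lgig E P) ! j"
  have len: "i < length (args G)" "j < length (args G)"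
    using P i j by (simp_all add: G_def length_args_lgig)
  have vars: "set (args G) \<subseteq> range Var"
    using P by (simp add: G_def args_lgig_vars)
  obtain x y where x: "args G ! i = Var x" and y: "args G ! j = Var y"
    using vars len by (metis imageE nth_mem subsetD)
  have xy: "x \<noteq> y"
    using ne x y by (simp add: G_def)
  define G' where "G' = subst_lit (Var(x := Var y)) G"
  have "\<exists>\<theta>. map (subst_term \<theta>) (args G') = args_of D P" if D: "D \<in> E" for D
  proof -
    obtain \<theta> where \<theta>: "map (subst_term \<theta>) (args G) = args_of D P"
      using P D unfolding G_def by (rule lgig_instance)
    have "\<theta> x = \<theta> y"
      using eq[OF D] x y len by (simp add: proj_def flip: \<theta>)
    then have "map (subst_term \<theta>) (args G') = map (subst_term \<theta>) (args G)"
      using vars by (auto simp: G'_def)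
    then show ?thesis
      using \<theta> by auto
  qed
  moreover have "set (args G') \<subseteq> range Var"
    using vars by (auto simp: G'_def)
  moreover have "signed_rel G' = P"
    using P by (simp add: G'_def G_def)
  ultimately have "induced_guard E P G'"
    using P by (simp add: induced_guard_iff)
  then have "card (vars_lit G) \<le> card (vars_lit G')"
    unfolding G_def lgig_def by (rule arg_min_nat_le)
  moreover have "vars_lit G' \<subset> vars_lit G"
  proof -
    have "Var x \<in> set (args G)" "Var y \<in> set (args G)"
      using x y len by (metis nth_mem)+
    then have xin: "x \<in> vars_lit G" and yin: "y \<in> vars_lit G"
      by (force simp: vars_lit_eq)+
    have "vars_lit G' \<subseteq> vars_lit G \<union> {y} - {x}"
      using vars xy by (fastforce simp: vars_lit_eq G'_def split: if_splits)
    then show ?thesis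
      using xin yin by blast
  qed
  ultimately show False
    using psubset_card_mono[OF finite_vars_lit] by (metis not_le)
qed

section \<open>Lgig maps and the clause built by the inner loop\<close>

text \<open>Leaves out the subsumption test of \<open>extend\<close>, which always succeeds when
  \<open>A\<close> lies in an example.\<close>

definition lgig_maps :: "'r signed_rel \<Rightarrow> ('f, 'v, 'r) literal set \<Rightarrow> ('f, 'v, 'r) clause" where
  "lgig_maps P A = lgig_map E (lgig E P) ` {L \<in> A. lgig_map_exists E (lgig E P) L}"

text \<open>Argument \<open>i\<close> of the lgig map is the lgig argument at some shield position
  \<open>j\<close>. There \<theta> yields \<open>proj D P j\<close>, which the shield equates with
  \<open>proj D (signed_rel L) i\<close>. As \<theta> does not depend on \<open>L\<close>, one
  substitution serves all lgig maps at once.\<close>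

lemma lgig_map_instance:
  assumes P: "occurs P" and C: "C \<in> E" "L \<in> C" and D: "D \<in> E"
    and ex: "lgig_map_exists E (lgig E P) L"
    and \<theta>: "map (subst_term \<theta>) (args (lgig E P)) = args_of D P"
  shows "subst_lit \<theta> (lgig_map E (lgig E P) L) \<in> D"
proof -
  let ?\<mu> = "lgig_map E (lgig E P) L"
  have occ: "occurs (signed_rel L)"
    using C by (rule occursI)
  obtain K where K: "K \<in> D" "signed_rel K = signed_rel L" "args K = args_of D (signed_rel L)"
    using occ D by (rule occurs_in_example)
  have len: "length (args L) = length (args K)"
    using C occ D K(3) length_args_of args_of_eq straight by metis
  have "map (subst_term \<theta>) (args ?\<mu>) = args K"
  proof (rule nth_equalityI)
    fix i assume "i < length (map (subst_term \<theta>) (args ?\<mu>))"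
    then have i: "i < length (args L)"
      by simp
    obtain j where j: "j \<in> rel_shield E P (signed_rel L) i"
        "args ?\<mu> ! i = args (lgig E P) ! j"
      using args_lgig_map_nth[OF ex i] P by auto
    then have jl: "j < ar (snd P)" and "proj D P j = proj D (signed_rel L) i"
      using P D by (auto simp: in_rel_shield_iff)
    moreover have "subst_term \<theta> (args (lgig E P) ! j) = proj D P j"
      using jl P by (simp add: proj_def length_args_lgig flip: \<theta>)
    ultimately show "map (subst_term \<theta>) (args ?\<mu>) ! i = args K ! i"
      using i j K by (simp add: proj_def)
  qed (use len in simp)
  then have "subst_lit \<theta> ?\<mu> = K"
    using K by (intro literal_eqI) auto
  then show ?thesis
    using K by simp
qed

lemma subsumes_all_lgig_maps:
  assumes P: "occurs P" and C: "C \<in> E" "A \<subseteq> C"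
  shows "subsumes_all (insert (lgig E P) (lgig_maps P A)) E"
  unfolding subsumes_all_def
proof
  fix D assume D: "D \<in> E"
  obtain \<theta> where \<theta>: "map (subst_term \<theta>) (args (lgig E P)) = args_of D P"
    using P D by (rule lgig_instance)
  obtain K where "K \<in> D" "signed_rel K = P" "args K = args_of D P"
    using P D by (rule occurs_in_example)
  then have "subst_lit \<theta> (lgig E P) \<in> D"
    using \<theta> P by (metis literal_eqI signed_rel_lgig subst_lit_sel)
  moreover have "subst_lit \<theta> ` lgig_maps P A \<subseteq> D"
    using lgig_map_instance[OF P C(1) _ D _ \<theta>] C(2) by (auto simp: lgig_maps_def)
  ultimately show "subsumes (insert (lgig E P) (lgig_maps P A)) D"
    by (auto simp: subsumes_def)
qed

text \<open>Every existing lgig map passes the test in \<open>extend\<close>, so the order of the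
  inner loop does not affect its result. Induction from the end of the list matches
  \<open>fold\<close>, which treats the last literal last.\<close>

lemma fold_extend_eq:
  assumes P: "occurs P" and C: "C \<in> E" "set Ls \<subseteq> C"
  shows "fold (extend E (lgig E P)) Ls {lgig E P} = insert (lgig E P) (lgig_maps P (set Ls))"
  using C(2)
proof (induction Ls rule: rev_induct)
  case Nil
  then show ?case by (simp add: lgig_maps_def)
next
  case (snoc L Ls)
  have *: "lgig_maps P (set (Ls @ [L])) =
      (if lgig_map_exists E (lgig E P) L
       then insert (lgig_map E (lgig E P) L) (lgig_maps P (set Ls)) else lgig_maps P (set Ls))"
    by (auto simp: lgig_maps_def)
  \<comment> \<open>If the lgig map of \<open>L\<close> exists, this is the test that
    \<open>extend\<close> makes for \<open>L\<close>.\<close>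
  have "subsumes_all (insert (lgig E P) (lgig_maps P (set (Ls @ [L])))) E"
    using P C(1) snoc.prems by (rule subsumes_all_lgig_maps)
  then show ?case
    using snoc unfolding *
    by (cases "lgig_map_exists E (lgig E P) L") (simp_all add: extend_def insert_commute)
qed

lemma lgig_map_vars:
  assumes P: "occurs P" and ex: "lgig_map_exists E (lgig E P) L"
  shows "set (args (lgig_map E (lgig E P) L)) \<subseteq> set (args (lgig E P))"
proof
  fix t assume "t \<in> set (args (lgig_map E (lgig E P) L))"
  then obtain i where i: "i < length (args L)" "t = args (lgig_map E (lgig E P) L) ! i"
    by (auto simp: in_set_conv_nth)
  obtain j where "j \<in> rel_shield E P (signed_rel L) i" "t = args (lgig E P) ! j"
    using args_lgig_map_nth[OF ex i(1)] P i(2) by auto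
  then show "t \<in> set (args (lgig E P))"
    using P by (auto simp: in_rel_shield_iff length_args_lgig)
qed

text \<open>The lgig is the guard, since every lgig map draws its arguments from it.\<close>

lemma guarded_clause_lgig_maps:
  assumes P: "occurs P" and C: "C \<in> E" "A \<subseteq> C"
  defines "H \<equiv> insert (lgig E P) (lgig_maps P A)"
  shows "is_clause ar H" and "function_free H" and "guarded H"
proof -
  have fin: "finite C" and arC: "\<And>L. L \<in> C \<Longrightarrow> length (args L) = ar (rel L)"
    using clause[OF C(1)] by (auto simp: is_clause_def)
  have rel: "rel L = snd (signed_rel L)" for L :: "('f, 'v, 'r) literal"
    by (simp add: signed_rel_def)
  have "finite A"
    using fin C(2) by (rule rev_finite_subset)
  then show "is_clause ar H"
    using P arC C(2) by (auto simp: is_clause_def H_def lgig_maps_def length_args_lgig rel)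
  have sub: "set (args L) \<subseteq> set (args (lgig E P))" if "L \<in> H" for L
    using that lgig_map_vars[OF P] by (auto simp: H_def lgig_maps_def)
  show "function_free H"
    unfolding function_free_iff using sub args_lgig_vars[OF P] by blast
  show "guarded H"
    unfolding guarded_def
  proof (intro bexI)
    show "\<Union> (vars_lit ` H) \<subseteq> vars_lit (lgig E P)"
      using sub by (fastforce simp: vars_lit_eq)
  qed (simp add: H_def)
qed

section \<open>Maximality of the constructed clause\<close>

text \<open>Equal arguments in \<open>H\<close> force equal terms in all examples, hence common
  shield positions and equal lgig arguments. So \<sigma> can be read off the guard position by
  position.\<close>

lemma lgig_maps_maximal:
  assumes C: "C \<in> E" and ff: "function_free H"
    and G\<^sub>0: "G\<^sub>0 \<in> H" "\<Union> (vars_lit ` H) \<subseteq> vars_lit G\<^sub>0"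
    and sub: "subsumes_all H E" and G: "G \<in> C" "signed_rel G = signed_rel G\<^sub>0"
  defines "P \<equiv> signed_rel G\<^sub>0"
  shows "\<exists>\<sigma>. subst_lit \<sigma> ` H \<subseteq> insert (lgig E P) (lgig_maps P (C - {G}))"
proof -
  \<comment> \<open>By straightness the image of \<open>L\<close> is the only literal of its signed
    relation in \<open>D\<close>. One \<theta> serves all of \<open>H\<close>, so equalities between
    arguments in \<open>H\<close> carry over to projections of \<open>D\<close>.\<close>
  have inst: "\<exists>\<theta>. \<forall>L\<in>H. occurs (signed_rel L) \<and>
      args_of D (signed_rel L) = map (subst_term \<theta>) (args L)" if D: "D \<in> E" for D
  proof -
    obtain \<theta> where \<theta>: "subst_lit \<theta> ` H \<subseteq> D"
      using sub D by (auto simp: subsumes_all_def subsumes_def)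
    have "occurs (signed_rel L) \<and> args_of D (signed_rel L) = map (subst_term \<theta>) (args L)"
      if "L \<in> H" for L
    proof -
      have "subst_lit \<theta> L \<in> D"
        using \<theta> that by blast
      then show ?thesis
        using occursI[OF D, of "subst_lit \<theta> L"] args_of_eq[OF straight[OF D], of "subst_lit \<theta> L"]
        by simp
    qed
    then show ?thesis
      by blast
  qed
  have occ: "occurs (signed_rel L)" if "L \<in> H" for L
    using inst[OF C] that by blast
  have len: "length (args L) = ar (snd (signed_rel L))" if "L \<in> H" for L
    using inst[OF C] length_args_of[OF occ[OF that] C] that by (metis length_map)
  have P: "occurs P"
    using occ G\<^sub>0 by (simp add: P_def)
  have lenG\<^sub>0: "length (args G\<^sub>0) = ar (snd P)"
    using len G\<^sub>0 by (simp add: P_def)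
  have vars: "set (args L) \<subseteq> range Var" if "L \<in> H" for L
    using ff that by (simp add: function_free_iff)
  have shield: "j \<in> rel_shield E P (signed_rel L) i"
    if L: "L \<in> H" and i: "i < length (args L)" and j: "j < ar (snd P)"
      and eq: "args L ! i = args G\<^sub>0 ! j" for L i j
  proof -
    have "proj D P j = proj D (signed_rel L) i" if "D \<in> E" for D
      using inst[OF that] L G\<^sub>0(1) i j eq lenG\<^sub>0 by (auto simp: proj_def P_def)
    then show ?thesis
      using P j by (simp add: in_rel_shield_iff)
  qed
  \<comment> \<open>Positions in a common shield carry equal terms in every example, so minimality
    of the lgig identifies its arguments there.\<close>
  have lgig_eq: "args (lgig E P) ! j = args (lgig E P) ! k"
    if "j \<in> rel_shield E P Q i" "k \<in> rel_shield E P Q i" for Q i j k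
    using that P by (intro lgig_args_eqI) (auto simp: in_rel_shield_iff)
  have "\<exists>\<sigma>. map (subst_term \<sigma>) (args G\<^sub>0) = args (lgig E P)"
  proof (rule exists_subst_map_eq)
    \<comment> \<open>Both \<open>i\<close> and \<open>j\<close> lie in the shield of
      \<open>P\<close> relative to itself at position \<open>i\<close>.\<close>
    fix i j assume "i < length (args G\<^sub>0)" "j < length (args G\<^sub>0)" "args G\<^sub>0 ! i = args G\<^sub>0 ! j"
    then show "args (lgig E P) ! i = args (lgig E P) ! j"
      using shield[OF G\<^sub>0(1)] lenG\<^sub>0 by (intro lgig_eq[of i P i j]) (auto simp: P_def)
  qed (use vars G\<^sub>0 lenG\<^sub>0 P in \<open>auto simp: length_args_lgig\<close>)
  then obtain \<sigma> where \<sigma>: "map (subst_term \<sigma>) (args G\<^sub>0) = args (lgig E P)" ..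
  have pos: "\<exists>j. j \<in> rel_shield E P (signed_rel L) i \<and>
      subst_term \<sigma> (args L ! i) = args (lgig E P) ! j"
    if L: "L \<in> H" and i: "i < length (args L)" for L i
  proof -
    have Li: "args L ! i \<in> set (args L)"
      using i by simp
    then obtain x where x: "args L ! i = Var x"
      using vars[OF L] by blast
    then have "x \<in> vars_lit L"
      using Li by (force simp: vars_lit_eq)
    \<comment> \<open>Guardedness enters here: the variable also occurs in \<open>G\<^sub>0\<close>,
      and a position of it there is the required \<open>j\<close>.\<close>
    then have "x \<in> vars_lit G\<^sub>0"
      using G\<^sub>0(2) L by blast
    then obtain t where t: "t \<in> set (args G\<^sub>0)" "x \<in> vars_term t"
      by (auto simp: vars_lit_eq)
    moreover have "t \<in> range Var"
      using vars[OF G\<^sub>0(1)] t(1) by blast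
    ultimately have "Var x \<in> set (args G\<^sub>0)"
      by auto
    then obtain j where j: "j < ar (snd P)" "args G\<^sub>0 ! j = Var x"
      using lenG\<^sub>0 by (auto simp: in_set_conv_nth)
    have "subst_term \<sigma> (args L ! i) = args (lgig E P) ! j"
      using j x lenG\<^sub>0 by (simp flip: \<sigma>)
    then show ?thesis
      using shield[OF L i j(1)] j x by auto
  qed
  have "subst_lit \<sigma> L \<in> insert (lgig E P) (lgig_maps P (C - {G}))" if L: "L \<in> H" for L
  proof (cases "signed_rel L = P")
    case True
    \<comment> \<open>\<open>H\<close> may contain several literals of \<open>P\<close>; \<sigma>
      collapses all of them onto the lgig, because position \<open>i\<close> lies in its own
      shield.\<close>
    have "map (subst_term \<sigma>) (args L) = args (lgig E P)"
    proof (rule nth_equalityI)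
      fix i assume "i < length (map (subst_term \<sigma>) (args L))"
      then have i: "i < length (args L)"
        by simp
      have "i \<in> rel_shield E P P i"
        using i len[OF L] True P by (simp add: in_rel_shield_iff)
      then show "map (subst_term \<sigma>) (args L) ! i = args (lgig E P) ! i"
        using pos[OF L i] i True lgig_eq by (metis nth_map)
    qed (use len[OF L] True P in \<open>simp add: length_args_lgig\<close>)
    then have "subst_lit \<sigma> L = lgig E P"
      using True P by (intro literal_eqI) auto
    then show ?thesis
      by simp
  next
    case False
    \<comment> \<open>An lgig map depends only on the signed relation and the length of its literal,
      so \<open>K\<close> stands in for \<open>L\<close>. As its signed relation is not
      \<open>P\<close>, it differs from \<open>G\<close> and is visited by the inner loop.\<close>
    obtain K where K: "K \<in> C" "signed_rel K = signed_rel L" "args K = args_of C (signed_rel L)"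
      using occ[OF L] C by (rule occurs_in_example)
    have lenK: "length (args K) = length (args L)"
      using K(3) len[OF L] length_args_of[OF occ[OF L] C] by simp
    have KG: "K \<in> C - {G}"
      using K G False by (auto simp: P_def)
    have ex: "lgig_map_exists E (lgig E P) K"
      using pos[OF L] P K(2) lenK by (fastforce simp: lgig_map_exists_def)
    have "map (subst_term \<sigma>) (args L) = args (lgig_map E (lgig E P) K)"
    proof (rule nth_equalityI)
      fix i assume "i < length (map (subst_term \<sigma>) (args L))"
      then have i: "i < length (args L)"
        by simp
      then obtain j where "j \<in> rel_shield E P (signed_rel L) i"
          "args (lgig_map E (lgig E P) K) ! i = args (lgig E P) ! j"
        using args_lgig_map_nth[OF ex] K(2) lenK P by (metis signed_rel_lgig)
      \<comment> \<open>The shield position chosen by \<open>lgig_map\<close> may differ from the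
        one in \<open>pos\<close>; \<open>lgig_eq\<close> reconciles them.\<close>
      then show "map (subst_term \<sigma>) (args L) ! i = args (lgig_map E (lgig E P) K) ! i"
        using pos[OF L i] i lgig_eq by (metis nth_map)
    qed (use lenK in simp)
    then have "subst_lit \<sigma> L = lgig_map E (lgig E P) K"
      using K(2) by (intro literal_eqI) auto
    then show ?thesis
      using KG ex by (auto simp: lgig_maps_def)
  qed
  then show ?thesis
    by blast
qed

section \<open>Correctness of the outer loop\<close>

lemma algorithm1_sound:
  assumes C: "C \<in> E" and ord: "\<And>G. G \<in> C \<Longrightarrow> set (ord G) \<subseteq> C" and "set Gs \<subseteq> C"
    and "algorithm1 E En ord Gs = Some H"
  shows "consistent_guarded_clause ar E En H"
  using assms(3,4)
proof (induction Gs)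
  case (Cons G Gs)
  define P where "P = signed_rel G"
  have P: "occurs P"
    using C Cons.prems(1) by (auto simp: P_def intro: occursI)
  \<comment> \<open>\<open>A = {}\<close> covers the early return of the lgig alone,
    \<open>A = set (ord G)\<close> the return after the inner loop.\<close>
  have cons: "consistent_guarded_clause ar E En (insert (lgig E P) (lgig_maps P A))"
    if "A \<subseteq> C" "subsumes_none (insert (lgig E P) (lgig_maps P A)) En" for A
    unfolding consistent_guarded_clause_def
    using that guarded_clause_lgig_maps[OF P C that(1)] subsumes_all_lgig_maps[OF P C that(1)]
    by blast
  have fold: "fold (extend E (lgig E P)) (ord G) {lgig E P}
      = insert (lgig E P) (lgig_maps P (set (ord G)))"
    using P C ord Cons.prems(1) by (intro fold_extend_eq) auto
  have "lgig_maps P {} = {}"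
    by (simp add: lgig_maps_def)
  then show ?case
    using Cons cons[of "{}"] cons[of "set (ord G)"] ord
    by (auto simp: Let_def fold simp flip: P_def split: if_splits)
qed simp

text \<open>Only the iteration at \<open>G\<close> needs inspection: its full clause passes the
  negative test by maximality, and any earlier return prevents rejection as well.\<close>

lemma algorithm1_complete:
  assumes C: "C \<in> E" and ord: "\<And>G. G \<in> C \<Longrightarrow> set (ord G) = C - {G}" and "set Gs \<subseteq> C"
    and H: "consistent_guarded_clause ar E En H"
    and G\<^sub>0: "G\<^sub>0 \<in> H" "\<Union> (vars_lit ` H) \<subseteq> vars_lit G\<^sub>0"
    and G: "G \<in> set Gs" "signed_rel G = signed_rel G\<^sub>0"
  shows "algorithm1 E En ord Gs \<noteq> None"
  using assms(3) G(1)
proof (induction Gs)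
  case (Cons G' Gs)
  have "subsumes_none (fold (extend E (lgig E (signed_rel G))) (ord G) {lgig E (signed_rel G)}) En"
    if "G' = G"
  proof -
    let ?P = "signed_rel G"
    have GC: "G \<in> C"
      using Cons.prems that by simp
    obtain \<sigma> where \<sigma>: "subst_lit \<sigma> ` H \<subseteq> insert (lgig E ?P) (lgig_maps ?P (C - {G}))"
      using lgig_maps_maximal[OF C _ G\<^sub>0 _ GC G(2)] H G(2)
      by (auto simp: consistent_guarded_clause_def)
    have "fold (extend E (lgig E ?P)) (ord G) {lgig E ?P}
        = insert (lgig E ?P) (lgig_maps ?P (C - {G}))"
      using fold_extend_eq[OF occursI[OF C GC] C, of "ord G"] ord[OF GC] by simp
    then show ?thesis
      using subsumes_if_instance[OF \<sigma>] H
      by (auto simp: subsumes_none_def consistent_guarded_clause_def)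
  qed
  then show ?case
    using Cons by (auto simp: Let_def)
qed simp

end

theorem theorem10:
  fixes ar :: "'r \<Rightarrow> nat"
    and Ep En :: "('f, 'v, 'r) clause set"
    and C :: "('f, 'v, 'r) clause"
    and Gs :: "('f, 'v, 'r) literal list"
    and ord :: "('f, 'v, 'r) literal \<Rightarrow> ('f, 'v, 'r) literal list"
  assumes "infinite (UNIV :: 'v set)"
    and "Ep \<noteq> {}"
    and "\<forall>D\<in>Ep. is_clause ar D \<and> ground D \<and> straight D"
    and "\<forall>D\<in>En. is_clause ar D \<and> ground D"
    and "\<forall>P. (\<exists>D\<in>Ep. P \<in> signed_rel ` D) \<longrightarrow> (\<forall>D\<in>Ep. P \<in> signed_rel ` D)"
    and "C \<in> Ep"
    and "enumerates Gs C"
    and "\<forall>G\<in>C. enumerates (ord G) (C - {G})"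
  shows "((\<exists>H. consistent_guarded_clause ar Ep En H) \<longrightarrow>
            (\<exists>H. algorithm1 Ep En ord Gs = Some H \<and> consistent_guarded_clause ar Ep En H)) \<and>
         ((\<nexists>H. consistent_guarded_clause ar Ep En H) \<longrightarrow>
            algorithm1 Ep En ord Gs = None)"
proof -
  interpret uniform_straight_examples ar Ep
    using assms by unfold_locales blast+
  have ord: "set (ord G) = C - {G}" if "G \<in> C" for G
    using assms(8) that by (simp add: enumerates_def)
  have Gs: "set Gs = C"
    using assms(7) by (simp add: enumerates_def)
  have sound: "consistent_guarded_clause ar Ep En H" if "algorithm1 Ep En ord Gs = Some H" for H
    using algorithm1_sound[OF assms(6) _ _ that] ord Gs by blast
  moreover have "algorithm1 Ep En ord Gs \<noteq> None" if H: "consistent_guarded_clause ar Ep En H" for H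
  proof -
    obtain G\<^sub>0 where G\<^sub>0: "G\<^sub>0 \<in> H" "\<Union> (vars_lit ` H) \<subseteq> vars_lit G\<^sub>0"
      using H by (auto simp: consistent_guarded_clause_def guarded_def)
    obtain \<theta> where "subst_lit \<theta> ` H \<subseteq> C"
      using H assms(6)
      by (auto simp: consistent_guarded_clause_def subsumes_all_def subsumes_def)
    \<comment> \<open>The image of the guard in the picked clause is the literal whose iteration
      guarantees a return.\<close>
    then have "subst_lit \<theta> G\<^sub>0 \<in> set Gs"
      using G\<^sub>0 Gs by blast
    then show ?thesis
      using algorithm1_complete[OF assms(6) ord _ H G\<^sub>0] Gs by simp
  qed
  \<comment> \<open>Rejection in the absence of a consistent clause is soundness read
    contrapositively.\<close>
  ultimately show ?thesis
    by (metis not_None_eq)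
qed

end
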